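(* Let $n\geq 3$ and let $F\colon\mathbb{F}_2^n\to\mathbb{F}_2^n$ be an APN function. Then $\mathcal{L}(F)\leq 2^n-4$.
   Context: A function $F\colon\mathbb{F}_2^n\to\mathbb{F}_2^n$ is almost perfect nonlinear (APN) if for every $a\in\mathbb{F}_2^n\setminus\{0\}$ and every $b\in\mathbb{F}_2^n$ the equation $F(x)+F(x+a)=b$ has at most $2$ solutions $x\in\mathbb{F}_2^n$. With $\cdot$ the usual inner product on $\mathbb{F}_2^n$, the Walsh transform of $F$ is $W_F(a,b)=\sum_{x\in\mathbb{F}_2^n}(-1)^{a\cdot x+b\cdot F(x)}\in\mathbb{Z}$, and the linearity of $F$ is $\mathcal{L}(F)=\max_{a\in\mathbb{F}_2^n,\ b\in\mathbb{F}_2^n\setminus\{0\}}|W_F(a,b)|$. *)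

theory Defs
  imports "HOL-Analysis.Analysis" "HOL-Library.Z2"
begin

text \<open>
  The space of vectors of length \<open>n\<close> over the field with two elements is \<^typ>\<open>bit ^ 'n\<close>
  with \<open>n = CARD('n)\<close>.
\<close>

text \<open>Without this instance, cardinalities of subsets of \<^typ>\<open>bit ^ 'n\<close> could default to 0.\<close>

instance bit :: finite
proof
  have "(UNIV :: bit set) = {0, 1}"
    using bit.exhaust by blast
  then show "finite (UNIV :: bit set)"
    by (metis finite.emptyI finite.insertI)
qed

definition APN :: "(bit ^ 'n \<Rightarrow> bit ^ 'n) \<Rightarrow> bool"
  where "APN F \<longleftrightarrow> (\<forall>a b. a \<noteq> 0 \<longrightarrow> card {x. F x + F (x + a) = b} \<le> 2)"

text \<open>The class-based inner product of the library only exists over the reals.\<close>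

definition dot :: "bit ^ 'n \<Rightarrow> bit ^ 'n \<Rightarrow> bit"  (infixl "\<cdot>" 70)
  where "x \<cdot> y = (\<Sum>i\<in>UNIV. x $ i * y $ i)"

text \<open>The exponent is an element of the two-element field, lifted to the natural number 0 or 1.\<close>

definition walsh :: "(bit ^ 'n \<Rightarrow> bit ^ 'n) \<Rightarrow> bit ^ 'n \<Rightarrow> bit ^ 'n \<Rightarrow> int"
  where "walsh F a b = (\<Sum>x\<in>UNIV. (-1) ^ (of_bit (a \<cdot> x + b \<cdot> F x) :: nat))"

definition linearity :: "(bit ^ 'n \<Rightarrow> bit ^ 'n) \<Rightarrow> int"
  where "linearity F = Max {\<bar>walsh F a b\<bar> | a b. b \<noteq> 0}"

end

theory Submission
  imports Defs
begin

text \<open>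
  Let \<open>N = 2\<^sup>n\<close>. Since \<open>W(a, b) = N - 2 k\<close>, where \<open>k\<close> counts the points with
  \<open>a \<cdot> x + b \<cdot> F x = 1\<close>, a Walsh value beyond \<open>N - 4\<close> in modulus means that the component
  \<open>b \<cdot> F\<close> is affine off some point \<open>x0\<close>. The value of \<open>F\<close> at \<open>x0\<close> can then be changed so that
  every derivative in a nonzero direction covers, two-to-one, a full coset of the hyperplane
  orthogonal to \<open>b\<close>. Hence all components \<open>c \<cdot> F\<close> with \<open>c \<noteq> 0, b\<close> are bent, that is, modulo a
  line \<open>{0, e}\<close> with \<open>e \<cdot> b = 1\<close>, \<open>F\<close> is a vectorial bent function into dimension \<open>n - 1\<close>, which Nyberg's
  divisibility argument excludes for \<open>n \<ge> 3\<close>.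
\<close>

section \<open>Additive characters\<close>

definition chi :: "bit \<Rightarrow> int"
  where "chi t = (-1) ^ (of_bit t :: nat)"

lemma chi_simps [simp]: "chi 0 = 1" "chi 1 = -1"
  by (simp_all add: chi_def)

lemma chi_add: "chi (s + t) = chi s * chi t"
  by (cases s; cases t) simp_all

lemma bit_vec_add_self [simp]: "x + x = 0" for x :: "bit ^ 'n"
  by (simp add: vec_eq_iff)

lemma bit_vec_add_self_left [simp]: "x + (x + y) = y" for x y :: "bit ^ 'n"
  by (metis add.assoc add.left_neutral bit_vec_add_self)

lemma bit_vec_add_self_right [simp]: "y + x + x = y" for x y :: "bit ^ 'n"
  by (simp add: add.assoc)

lemma bit_vec_add_eq_zero_iff [simp]: "x + y = 0 \<longleftrightarrow> x = y" for x y :: "bit ^ 'n"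
  by (metis add.right_neutral bit_vec_add_self_left bit_vec_add_self)

lemma dot_zero [simp]: "x \<cdot> 0 = 0" "0 \<cdot> x = 0"
  by (simp_all add: dot_def)

lemma dot_add_right: "x \<cdot> (y + z) = x \<cdot> y + x \<cdot> z"
  by (simp only: dot_def vector_add_component distrib_left sum.distrib)

lemma dot_add_left: "(x + y) \<cdot> z = x \<cdot> z + y \<cdot> z"
  by (simp only: dot_def vector_add_component distrib_right sum.distrib)

lemma dot_commute: "x \<cdot> y = y \<cdot> x"
  unfolding dot_def by (intro sum.cong mult.commute refl)

lemma ex_dot_eq_one:
  fixes b :: "bit ^ 'n"
  assumes "b \<noteq> 0"
  obtains e where "b \<cdot> e = 1"
proof -
  obtain i where i: "b $ i = 1"
    using assms by (metis bit_not_zero_iff vec_eq_iff zero_index)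
  have "b \<cdot> axis i 1 = (\<Sum>j\<in>UNIV. if j = i then 1 else 0)"
    unfolding dot_def by (intro sum.cong) (auto simp: axis_def i)
  then show thesis
    using that by simp
qed

text \<open>Take \<open>e\<close> with \<open>c \<cdot> e = 1\<close> and \<open>f\<close> with
  \<open>(b + c) \<cdot> f = 1\<close>; one of \<open>e\<close>, \<open>f\<close>,
  \<open>e + f\<close> serves as \<open>w\<close>.\<close>

lemma ex_dot_eq_zero_one:
  fixes b c :: "bit ^ 'n"
  assumes "c \<noteq> 0" "c \<noteq> b"
  obtains w where "b \<cdot> w = 0" "c \<cdot> w = 1"
proof -
  obtain e where e: "c \<cdot> e = 1"
    using assms(1) by (rule ex_dot_eq_one)
  have "b + c \<noteq> 0"
    using assms(2) by auto
  then obtain f where f: "b \<cdot> f + c \<cdot> f = 1"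
    by (rule ex_dot_eq_one) (simp add: dot_add_left that)
  show thesis
  proof (cases "b \<cdot> e = 0 \<or> b \<cdot> f = 0")
    case True
    then show thesis
      using that e f by auto
  next
    case False
    then have "b \<cdot> e = 1" "b \<cdot> f = 1" "c \<cdot> f = 0"
      using f by auto
    then show thesis
      using that[of "e + f"] e by (simp add: dot_add_right)
  qed
qed

lemma CARD_bit [simp]: "CARD(bit) = 2"
proof -
  have "(UNIV :: bit set) = {0, 1}"
    using bit.exhaust by blast
  then have "CARD(bit) = card {0, 1 :: bit}"
    by (rule arg_cong)
  then show ?thesis
    by simp
qed

text \<open>Pigeonhole: at least 8 vectors share 4 value pairs, and the difference of two colliding
  vectors is orthogonal to both.\<close>

lemma ex_common_orthogonal:
  fixes b c :: "bit ^ 'n"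
  assumes "CARD('n) \<ge> 3"
  obtains w where "w \<noteq> 0" "b \<cdot> w = 0" "c \<cdot> w = 0"
proof -
  let ?p = "\<lambda>w. (b \<cdot> w, c \<cdot> w)"
  have "(2::nat) ^ 3 \<le> 2 ^ CARD('n)"
    using assms by (rule power_increasing) simp
  moreover have "CARD(bit \<times> bit) = 4"
    by simp
  ultimately have "\<not> card (UNIV :: (bit ^ 'n) set) \<le> CARD(bit \<times> bit)"
    by simp
  then have "\<not> inj ?p"
    using card_inj_on_le[of ?p UNIV UNIV] by auto
  then obtain x y where "x \<noteq> y" "b \<cdot> x = b \<cdot> y" "c \<cdot> x = c \<cdot> y"
    by (auto simp: inj_def)
  then show thesis
    using that[of "x + y"] by (simp add: dot_add_right)
qed

section \<open>Sums over hyperplanes and their cosets\<close>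

text \<open>Translation by \<open>w\<close> flips \<open>e \<cdot> x\<close>, so it matches the two
  halves of \<open>S\<close>.\<close>

lemma sum_translate_pairs:
  fixes g :: "bit ^ 'n \<Rightarrow> 'a::comm_monoid_add"
  assumes "e \<cdot> w = 1" and closed: "\<And>x. x \<in> S \<Longrightarrow> x + w \<in> S"
  shows "sum g S = (\<Sum>x\<in>{x\<in>S. e \<cdot> x = 0}. g x + g (x + w))"
proof -
  have "sum g S = sum g {x\<in>S. e \<cdot> x = 0} + sum g {x\<in>S. e \<cdot> x = 1}"
    by (subst sum.union_disjoint[symmetric]) (auto intro!: sum.cong)
  also have "sum g {x\<in>S. e \<cdot> x = 1} = (\<Sum>x\<in>{x\<in>S. e \<cdot> x = 0}. g (x + w))"
    by (rule sum.reindex_bij_witness[of _ "\<lambda>x. x + w" "\<lambda>x. x + w"])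
      (auto simp: assms dot_add_right)
  finally show ?thesis
    by (simp add: sum.distrib)
qed

lemma card_hyperplane:
  fixes b :: "bit ^ 'n"
  assumes "b \<noteq> 0"
  shows "2 * card {v. b \<cdot> v = t} = 2 ^ CARD('n)"
proof -
  obtain e where e: "b \<cdot> e = 1"
    using assms by (rule ex_dot_eq_one)
  have "card {v. b \<cdot> v = 1} = card {v. b \<cdot> v = 0}"
    by (rule bij_betw_same_card[of "\<lambda>x. x + e"], rule bij_betw_byWitness[where f' = "\<lambda>x. x + e"])
      (auto simp: e dot_add_right)
  moreover have "card (UNIV :: (bit ^ 'n) set) = 2 * card {v. b \<cdot> v = 0}"
    using sum_translate_pairs[OF e, of UNIV "\<lambda>_. 1::nat"] by simp
  ultimately show ?thesis
    by (cases t) simp_all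
qed

text \<open>Some translation preserves the coset and flips the sign of every summand.\<close>

lemma sum_chi_hyperplane:
  fixes b c :: "bit ^ 'n"
  assumes "c \<noteq> 0" "c \<noteq> b"
  shows "(\<Sum>v\<in>{v. b \<cdot> v = t}. chi (c \<cdot> v)) = 0"
proof -
  obtain w where w: "b \<cdot> w = 0" "c \<cdot> w = 1"
    using assms by (rule ex_dot_eq_zero_one)
  have "(\<Sum>v\<in>{v. b \<cdot> v = t}. chi (c \<cdot> v)) =
      (\<Sum>v\<in>{v \<in> {v. b \<cdot> v = t}. c \<cdot> v = 0}. chi (c \<cdot> v) + chi (c \<cdot> (v + w)))"
    using w by (intro sum_translate_pairs) (auto simp: dot_add_right)
  also have "\<dots> = 0"
    by (intro sum.neutral) (simp add: dot_add_right w)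
  finally show ?thesis .
qed

lemma sum_hyperplane:
  fixes b :: "bit ^ 'n"
  assumes "CARD('n) \<ge> 3"
  shows "\<Sum>{v. b \<cdot> v = t} = 0"
proof -
  obtain w where w: "w \<noteq> 0" "b \<cdot> w = 0"
    using ex_common_orthogonal[OF assms, of b b] by metis
  obtain c where c: "c \<cdot> w = 1"
    using ex_dot_eq_one[OF w(1)] by (metis dot_commute)
  obtain w' where w': "w' \<noteq> 0" "b \<cdot> w' = 0" "c \<cdot> w' = 0"
    using ex_common_orthogonal[OF assms, of b c] by metis
  obtain c' where c': "c' \<cdot> w' = 1"
    using ex_dot_eq_one[OF w'(1)] by (metis dot_commute)
  let ?S = "{v \<in> {v. b \<cdot> v = t}. c \<cdot> v = 0}"
  have "\<Sum>{v. b \<cdot> v = t} = (\<Sum>v\<in>?S. v + (v + w))"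
    using c w by (intro sum_translate_pairs) (auto simp: dot_add_right)
  also have "\<dots> = (\<Sum>v\<in>?S. w)"
    by simp
  \<comment> \<open>Translation by \<open>w'\<close> preserves \<open>?S\<close>, so the constant
    \<open>w\<close> is added an even number of times.\<close>
  also have "\<dots> = (\<Sum>v\<in>{v\<in>?S. c' \<cdot> v = 0}. w + w)"
    using c' w' by (intro sum_translate_pairs) (auto simp: dot_add_right)
  finally show ?thesis
    by simp
qed

section \<open>Vectorial functions with balanced derivatives\<close>

text \<open>Substituting \<open>y = x + u\<close> turns the square into a sum over derivatives, of
  which only \<open>u = 0\<close> survives.\<close>

lemma sum_chi_squared:
  fixes G :: "bit ^ 'n \<Rightarrow> bit ^ 'n"
  assumes "\<And>u. u \<noteq> 0 \<Longrightarrow> (\<Sum>x\<in>UNIV. chi (c \<cdot> (G x + G (x + u)))) = 0"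
  shows "(\<Sum>x\<in>UNIV. chi (c \<cdot> G x))\<^sup>2 = 2 ^ CARD('n)"
proof -
  have "(\<Sum>x\<in>UNIV. chi (c \<cdot> G x))\<^sup>2 = (\<Sum>x\<in>UNIV. \<Sum>y\<in>UNIV. chi (c \<cdot> (G x + G y)))"
    by (simp only: power2_eq_square sum_product dot_add_right chi_add)
  also have "\<dots> = (\<Sum>x\<in>UNIV. \<Sum>u\<in>UNIV. chi (c \<cdot> (G x + G (x + u))))"
  proof (rule sum.cong[OF refl])
    fix x
    show "(\<Sum>y\<in>UNIV. chi (c \<cdot> (G x + G y))) = (\<Sum>u\<in>UNIV. chi (c \<cdot> (G x + G (x + u))))"
      by (rule sum.reindex_bij_witness[of _ "\<lambda>u. x + u" "\<lambda>y. x + y"]) auto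
  qed
  also have "\<dots> = (\<Sum>u\<in>UNIV. \<Sum>x\<in>UNIV. chi (c \<cdot> (G x + G (x + u))))"
    by (rule sum.swap)
  also have "\<dots> = (\<Sum>u\<in>(UNIV :: (bit ^ 'n) set). if u = 0 then 2 ^ CARD('n) else 0)"
    by (rule sum.cong) (auto simp: assms)
  finally show ?thesis
    by simp
qed

lemma balanced_derivatives_imp_False:
  fixes G :: "bit ^ 'n \<Rightarrow> bit ^ 'n"
  assumes n: "CARD('n) \<ge> 3" and b: "b \<noteq> 0"
    and bal: "\<And>c u. c \<noteq> 0 \<Longrightarrow> c \<noteq> b \<Longrightarrow> u \<noteq> 0 \<Longrightarrow>
      (\<Sum>x\<in>UNIV. chi (c \<cdot> (G x + G (x + u)))) = 0"
  shows False
proof -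
  define S where "S c = (\<Sum>x\<in>UNIV. chi (c \<cdot> G x))" for c
  have S: "(S c)\<^sup>2 = 2 ^ CARD('n)" if "c \<noteq> 0" "c \<noteq> b" for c
    unfolding S_def using bal[OF that] by (rule sum_chi_squared)
  obtain e where e: "e \<cdot> b = 1"
    using ex_dot_eq_one[OF b] by (metis dot_commute)
  then have [simp]: "e \<noteq> 0"
    by auto
  \<comment> \<open>A hyperplane avoiding \<open>b\<close>: the fact \<open>S\<close> applies to all
    its nonzero elements.\<close>
  define C where "C = {c. e \<cdot> c = 0}"
  have C: "0 \<in> C" "b \<notin> C"
    using e by (auto simp: C_def)
  \<comment> \<open>The sums \<open>S c\<close> with \<open>c \<in> C - {0}\<close> are \<open>\<plusminus> S w\<close>, and there is an odd number of them, so their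
    sum is an odd multiple of \<open>S w\<close>; but it is also divisible by half of \<open>(S w)\<^sup>2\<close>.\<close>
  obtain w where w: "w \<noteq> 0" "e \<cdot> w = 0"
    using ex_common_orthogonal[OF n, of e e] by metis
  then have w2: "(S w)\<^sup>2 = 2 ^ CARD('n)"
    using S[of w] e by fastforce
  define k where "k = (\<Sum>c\<in>C - {0}. if S c = S w then 1 else -1 :: int)"
  obtain m where m: "(2::nat) ^ CARD('n) = 8 * 2 ^ m"
    using le_Suc_ex[OF n] by (auto simp: power_add)
  have cardC: "card C = 4 * 2 ^ m"
    using card_hyperplane[of e 0] m by (simp add: C_def)
  then have "odd (card (C - {0}))"
    using C by (simp add: card_Diff_singleton)
  \<comment> \<open>All summands of \<open>k\<close> are odd, so \<open>k\<close> has the parity of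
    their number.\<close>
  then have "odd k"
    unfolding k_def by (subst even_sum_iff) (simp_all add: set_diff_eq)
  have "(\<Sum>c\<in>C. S c) = S 0 + (\<Sum>c\<in>C - {0}. S c)"
    using C by (simp add: sum.remove)
  also have "(\<Sum>c\<in>C - {0}. S c) = (\<Sum>c\<in>C - {0}. S w * (if S c = S w then 1 else -1))"
  proof (intro sum.cong refl)
    fix c assume c: "c \<in> C - {0}"
    then have "(S c)\<^sup>2 = (S w)\<^sup>2"
      using S C w2 by (metis DiffD1 DiffD2 singletonI)
    then show "S c = S w * (if S c = S w then 1 else -1)"
      by (auto simp: power2_eq_iff)
  qed
  finally have 1: "(\<Sum>c\<in>C. S c) = 2 ^ CARD('n) + S w * k"
    by (simp add: k_def sum_distrib_left S_def)
  have "(\<Sum>c\<in>C. S c) = (\<Sum>x\<in>UNIV. \<Sum>c\<in>C. chi (c \<cdot> G x))"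
    unfolding S_def by (rule sum.swap)
  \<comment> \<open>Orthogonality: only the \<open>G x\<close> in \<open>{0, e}\<close>, the
    orthogonal complement of \<open>C\<close>, contribute.\<close>
  also have "\<dots> = (\<Sum>x\<in>UNIV. 4 * 2 ^ m * (if G x \<in> {0, e} then 1 else 0))"
  proof (intro sum.cong refl)
    fix x
    show "(\<Sum>c\<in>C. chi (c \<cdot> G x)) = 4 * 2 ^ m * (if G x \<in> {0, e} then 1 else 0)"
    proof (cases "G x \<in> {0, e}")
      case True
      then have "chi (c \<cdot> G x) = 1" if "c \<in> C" for c
        using that by (auto simp: C_def dot_commute)
      then show ?thesis
        using True by (simp add: cardC)
    next
      case False
      then show ?thesis
        using sum_chi_hyperplane[of "G x" e 0] by (simp add: C_def dot_commute)
    qed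
  qed
  finally obtain M where "(\<Sum>c\<in>C. S c) = 4 * 2 ^ m * M"
    by (metis sum_distrib_left)
  moreover have N: "(2::int) ^ CARD('n) = 8 * 2 ^ m"
    using m by (metis of_nat_numeral of_nat_power of_nat_mult)
  ultimately have "S w * k = 4 * 2 ^ m * (M - 2)"
    using 1 by (simp add: algebra_simps)
  \<comment> \<open>Squaring brings in the known value of \<open>(S w)\<^sup>2\<close>, without a
    case split on the parity of the dimension.\<close>
  then have "(S w)\<^sup>2 * k\<^sup>2 = (4 * 2 ^ m)\<^sup>2 * (M - 2)\<^sup>2"
    by (metis power_mult_distrib)
  then have "(8 * 2 ^ m) * k\<^sup>2 = (8 * 2 ^ m) * (2 * 2 ^ m * (M - 2)\<^sup>2)"
    unfolding w2 N by (simp add: power2_eq_square)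
  then have "k\<^sup>2 = 2 * 2 ^ m * (M - 2)\<^sup>2"
    by simp
  then have "even (k\<^sup>2)"
    by simp
  with \<open>odd k\<close> show False
    by simp
qed

section \<open>APN functions with an almost affine component\<close>

text \<open>Solutions come in pairs \<open>{x, x + u}\<close> with one member in the hyperplane; a
  collision there would give a third solution.\<close>

lemma APN_derivative_inj_on:
  assumes "APN F" "e \<cdot> u = 1"
  shows "inj_on (\<lambda>x. F x + F (x + u)) {x. e \<cdot> x = 0}"
proof (rule inj_onI)
  fix x y
  assume xy: "x \<in> {x. e \<cdot> x = 0}" "y \<in> {x. e \<cdot> x = 0}"
    and eq: "F x + F (x + u) = F y + F (y + u)"
  have u: "u \<noteq> 0"
    using assms(2) by auto
  show "x = y"
  proof (rule ccontr)
    assume "x \<noteq> y"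
    moreover have "y \<noteq> x + u"
      using xy assms(2) by (auto simp: dot_add_right)
    ultimately have "card {x, x + u, y} = 3"
      using u by auto
    moreover have "card {x, x + u, y} \<le> card {z. F z + F (z + u) = F x + F (x + u)}"
      using eq by (intro card_mono) (auto simp: ac_simps)
    moreover have "\<dots> \<le> 2"
      using assms(1) u by (simp add: APN_def)
    ultimately show False
      by simp
  qed
qed

lemma APN_no_almost_affine_component:
  fixes F :: "bit ^ 'n \<Rightarrow> bit ^ 'n"
  assumes n: "CARD('n) \<ge> 3" and F: "APN F" and b: "b \<noteq> 0"
    and aff: "\<And>x. x \<noteq> x0 \<Longrightarrow> a \<cdot> x + b \<cdot> F x = t"
  shows False
proof (rule balanced_derivatives_imp_False[OF n b])
  \<comment> \<open>Replacing the exceptional value by \<open>T\<close> makes every derivative of \<open>F\<close> surjective onto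
    a coset of the hyperplane orthogonal to \<open>b\<close>: the one value missed in direction \<open>u\<close> is
    determined by the fact that the elements of such a coset sum to zero.\<close>
  define T where "T = (\<Sum>x\<in>UNIV - {x0}. F x)"
  let ?G = "F(x0 := T)"
  fix c u :: "bit ^ 'n"
  assume c: "c \<noteq> 0" "c \<noteq> b" and u: "u \<noteq> 0"
  obtain e where e: "e \<cdot> u = 1"
    using ex_dot_eq_one[OF u] by (metis dot_commute)
  then have [simp]: "e \<noteq> 0"
    by auto
  \<comment> \<open>\<open>R\<close> takes one point of each pair \<open>{x, x + u}\<close>, and
    \<open>r\<close> is the one from the pair of \<open>x0\<close>. Off that pair,
    \<open>aff\<close> puts the derivative into \<open>H\<close>.\<close>
  define R where "R = {x. e \<cdot> x = 0}"
  define H where "H = {v. b \<cdot> v = a \<cdot> u}"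
  define r where "r = (if x0 \<in> R then x0 else x0 + u)"
  define D where "D x = F x + F (x + u)" for x
  have rR: "r \<in> R"
    using e by (auto simp: r_def R_def dot_add_right)
  have R_r: "R - {r} = {x \<in> UNIV - {x0, x0 + u}. e \<cdot> x = 0}"
    using e by (auto simp: r_def R_def dot_add_right split: if_splits)
  have G_eq: "?G x + ?G (x + u) = D x" if "x \<in> R - {r}" for x
    using that unfolding R_r D_def by auto
  have "D ` (R - {r}) \<subseteq> H"
  proof
    fix v assume "v \<in> D ` (R - {r})"
    then obtain x where "x \<in> R - {r}" and v: "v = D x"
      by blast
    then have x: "x \<noteq> x0" "x + u \<noteq> x0"
      unfolding R_r by auto
    have "a \<cdot> x + b \<cdot> F x = a \<cdot> (x + u) + b \<cdot> F (x + u)"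
      using aff x by metis
    then show "v \<in> H"
      unfolding H_def v D_def mem_Collect_eq dot_add_right
      by (cases "a \<cdot> x"; cases "a \<cdot> u"; cases "b \<cdot> F x"; cases "b \<cdot> F (x + u)") simp_all
  qed
  moreover have injD: "inj_on D (R - {r})"
    using APN_derivative_inj_on[OF F e] unfolding D_def R_def by (rule inj_on_subset) auto
  moreover have "card R = card H" "card R > 0"
    using card_hyperplane[of e 0] card_hyperplane[OF b, of "a \<cdot> u"]
    by (auto simp: R_def H_def intro!: Nat.gr0I)
  ultimately have "card (H - D ` (R - {r})) = 1"
    using rR by (simp add: card_Diff_subset card_image)
  then obtain m where m: "H - D ` (R - {r}) = {m}"
    by (rule card_1_singletonE)
  with \<open>D ` (R - {r}) \<subseteq> H\<close> have H: "H = insert m (D ` (R - {r}))" "m \<notin> D ` (R - {r})"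
    by auto
  \<comment> \<open>Solving for the missed value \<open>m\<close> shows why one \<open>T\<close>,
    independent of \<open>u\<close>, repairs all directions.\<close>
  have "0 = \<Sum>H"
    using sum_hyperplane[OF n] by (simp add: H_def)
  also have "\<dots> = m + (\<Sum>x\<in>R - {r}. D x)"
    by (simp add: H sum.reindex[OF injD])
  also have "(\<Sum>x\<in>R - {r}. D x) = sum F (UNIV - {x0, x0 + u})"
    unfolding R_r D_def using e by (intro sum_translate_pairs[symmetric]) auto
  also have "\<dots> = T + F (x0 + u)"
  proof -
    have "T = F (x0 + u) + sum F (UNIV - {x0} - {x0 + u})"
      unfolding T_def using u by (intro sum.remove) auto
    then show ?thesis
      by (simp add: Diff_insert2[symmetric] ac_simps)
  qed
  finally have m_eq: "m = T + F (x0 + u)"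
    by (metis bit_vec_add_eq_zero_iff)
  have "?G r + ?G (r + u) = m"
    using u by (auto simp: r_def m_eq ac_simps)
  with G_eq have sumR: "(\<Sum>x\<in>R. chi (c \<cdot> (?G x + ?G (x + u)))) = (\<Sum>v\<in>H. chi (c \<cdot> v))"
    using rR H by (simp add: sum.remove sum.reindex[OF injD])
  have "(\<Sum>x\<in>UNIV. chi (c \<cdot> (?G x + ?G (x + u)))) =
      (\<Sum>x\<in>{x\<in>UNIV. e \<cdot> x = 0}. chi (c \<cdot> (?G x + ?G (x + u))) +
        chi (c \<cdot> (?G (x + u) + ?G (x + u + u))))"
    using e by (intro sum_translate_pairs) auto
  \<comment> \<open>A derivative takes the same value at \<open>x\<close> and
    \<open>x + u\<close>.\<close>
  also have "\<dots> = (\<Sum>x\<in>R. 2 * chi (c \<cdot> (?G x + ?G (x + u))))"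
    by (simp only: R_def bit_vec_add_self_right add.commute[of "?G (_ + u)"] mult_2[symmetric]) simp
  also have "\<dots> = 2 * (\<Sum>v\<in>H. chi (c \<cdot> v))"
    by (simp only: sumR flip: sum_distrib_left)
  also have "\<dots> = 0"
    using sum_chi_hyperplane[OF c] by (simp add: H_def)
  finally show "(\<Sum>x\<in>UNIV. chi (c \<cdot> (?G x + ?G (x + u)))) = 0" .
qed

section \<open>From exceptional points to the Walsh bound\<close>

lemma sum_chi_eq_card:
  fixes h :: "bit ^ 'n \<Rightarrow> bit"
  shows "(\<Sum>x\<in>UNIV. chi (h x)) = chi t * (2 ^ CARD('n) - 2 * int (card {x. h x \<noteq> t}))"
proof -
  have "(\<Sum>x\<in>UNIV. chi (h x)) = (\<Sum>x\<in>UNIV. chi t * (1 - 2 * of_bool (h x \<noteq> t)))"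
  proof (intro sum.cong refl)
    fix x
    show "chi (h x) = chi t * (1 - 2 * of_bool (h x \<noteq> t))"
      by (cases "h x"; cases t) simp_all
  qed
  also have "\<dots> = chi t * (\<Sum>x\<in>UNIV. 1 - 2 * of_bool (h x \<noteq> t))"
    by (rule sum_distrib_left[symmetric])
  also have "(\<Sum>x\<in>(UNIV :: (bit ^ 'n) set). 1 - 2 * of_bool (h x \<noteq> t) :: int) =
      2 ^ CARD('n) - 2 * (\<Sum>x\<in>(UNIV :: (bit ^ 'n) set). of_bool (h x \<noteq> t))"
    by (simp only: sum_subtractf flip: sum_distrib_left) simp
  also have "(\<Sum>x\<in>(UNIV :: (bit ^ 'n) set). of_bool (h x \<noteq> t)) = int (card {x. h x \<noteq> t})"
    by (subst sum_of_bool_eq) auto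
  finally show ?thesis .
qed

theorem corollary3p7:
  fixes F :: "bit ^ 'n \<Rightarrow> bit ^ 'n"
  assumes "CARD('n) \<ge> 3" and "APN F"
  shows "linearity F \<le> 2 ^ CARD('n) - 4"
proof -
  have "\<bar>walsh F a b\<bar> \<le> 2 ^ CARD('n) - 4" if b: "b \<noteq> 0" for a b
  proof -
    define W where "W = walsh F a b"
    define p where "p t = int (card {x. a \<cdot> x + b \<cdot> F x \<noteq> t})" for t
    have p: "p t \<ge> 2" for t
    proof (rule ccontr)
      assume "\<not> p t \<ge> 2"
      then have "card {x. a \<cdot> x + b \<cdot> F x \<noteq> t} \<le> Suc 0"
        by (simp add: p_def)
      then have "\<forall>x\<in>{x. a \<cdot> x + b \<cdot> F x \<noteq> t}. \<forall>y\<in>{x. a \<cdot> x + b \<cdot> F x \<noteq> t}. x = y"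
        by (subst (asm) card_le_Suc0_iff_eq) (rule finite)
      \<comment> \<open>If no point is exceptional, any \<open>x0\<close> will do.\<close>
      then obtain x0 where "a \<cdot> x + b \<cdot> F x = t" if "x \<noteq> x0" for x
        by blast
      then show False
        by (rule APN_no_almost_affine_component[OF assms b])
    qed
    have "W = chi t * (2 ^ CARD('n) - 2 * p t)" for t
      unfolding W_def p_def walsh_def chi_def[symmetric] by (rule sum_chi_eq_card)
    \<comment> \<open>The case \<open>t = 0\<close> bounds \<open>W\<close> from above,
      \<open>t = 1\<close> from below.\<close>
    from this[of 0] this[of 1] show ?thesis
      using p[of 0] p[of 1] by (simp add: W_def)
  qed
  moreover have "finite {\<bar>walsh F a b\<bar> | a b. b \<noteq> 0}"
    by (rule finite_subset[of _ "(\<lambda>(a, b). \<bar>walsh F a b\<bar>) ` UNIV"]) auto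
  \<comment> \<open>This makes the set under \<open>Max\<close> nonempty.\<close>
  moreover have "\<exists>b :: bit ^ 'n. b \<noteq> 0"
    using ex_common_orthogonal[OF assms(1)] by metis
  ultimately show ?thesis
    unfolding linearity_def by (subst Max_le_iff) auto
qed

end
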